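(* Let $D$ be a digraph on $n$ vertices and let $k=\max(\mathrm{kp}(D),2)$, where $\mathrm{kp}(D)$ is the kernel-perfect number of $D$. Then: \begin{itemize} \item[I.] If $D$ is sink-free, then $D$ has a quasi-kernel of size at most $\left(1-\frac1k\right)n$. \item[II.] $D$ has a quasi-kernel of size at most $n-\frac{s}{k}$, where $s$ is the number of sources of $D$ that are not sinks of $D$. \item[III.] $D$ has a quasi-kernel $Q$ such that $|N^-[Q]|\ge \frac{n}{k}$. \end{itemize}
   Context: Digraphs $D=(V(D),A(D))$ are finite, without loops or parallel arcs; a pair of opposite arcs $uv,vu$ (directed 2-cycle) is allowed. If $xy\in A(D)$, then $y$ is an out-neighbor of $x$ and $x$ is an in-neighbor of $y$. A sink is a vertex with no out-neighbors; a source is a vertex with no in-neighbors; a digraph is sink-free if it has no sinks. For vertices $u,v$, $\mathrm{dist}(u,v)\in\mathbb{Z}^{\ge 0}\cup\{\infty\}$ is the length of a shortest directed path from $u$ to $v$, and for $S\subseteq V(D)$, $\mathrm{dist}(u,S)=\min_{v\in S}\mathrm{dist}(u,v)$ (equal to $\infty$ if $S=\emptyset$). Define $N^-[S]=\{u\in V(D):\mathrm{dist}(u,S)\le 1\}$. A set of vertices is independent if there is no arc between any two of its vertices. A kernel of $D$ is an independent set $K\subseteq V(D)$ with $N^-[K]=V(D)$. A quasi-kernel of $D$ is an independent set $Q\subseteq V(D)$ such that $\mathrm{dist}(u,Q)\le 2$ for every $u\in V(D)$. A digraph is kernel-perfect if every induced subdigraph of it has a kernel; a vertex set $S\subseteq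 V(D)$ is called kernel-perfect if the induced subdigraph $D[S]$ is kernel-perfect. The kernel-perfect number $\mathrm{kp}(D)$ is the smallest $k$ such that $V(D)$ can be partitioned into $k$ kernel-perfect subsets. *)

theory Defs
  imports
    "Graph_Theory.Graph_Theory"
    "HOL-Library.Extended_Nat"
    "HOL-Library.Disjoint_Sets"
begin

definition out_neighbors :: "('a, 'b) pre_digraph \<Rightarrow> 'a \<Rightarrow> 'a set" where
  "out_neighbors D x = {y. x \<rightarrow>\<^bsub>D\<^esub> y}"

definition in_neighbors :: "('a, 'b) pre_digraph \<Rightarrow> 'a \<Rightarrow> 'a set" where
  "in_neighbors D y = {x. x \<rightarrow>\<^bsub>D\<^esub> y}"

definition is_sink :: "('a, 'b) pre_digraph \<Rightarrow> 'a \<Rightarrow> bool" where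
  "is_sink D v \<longleftrightarrow> v \<in> verts D \<and> out_neighbors D v = {}"

definition is_source :: "('a, 'b) pre_digraph \<Rightarrow> 'a \<Rightarrow> bool" where
  "is_source D v \<longleftrightarrow> v \<in> verts D \<and> in_neighbors D v = {}"

definition sink_free :: "('a, 'b) pre_digraph \<Rightarrow> bool" where
  "sink_free D \<longleftrightarrow> (\<nexists>v. is_sink D v)"

text \<open>
  Distances take values in \<^typ>\<open>enat\<close>, where the infimum of the empty set is \<open>\<infinity>\<close>
  and a nonempty infimum is attained; so unreachable pairs and the empty target set
  get distance \<open>\<infinity>\<close>.
\<close>

definition ddist :: "('a, 'b) pre_digraph \<Rightarrow> 'a \<Rightarrow> 'a \<Rightarrow> enat" where
  "ddist D u v = (INF p \<in> {p. pre_digraph.apath D u p v}. enat (length p))"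

definition ddist_set :: "('a, 'b) pre_digraph \<Rightarrow> 'a \<Rightarrow> 'a set \<Rightarrow> enat" where
  "ddist_set D u S = (INF v \<in> S. ddist D u v)"

definition closed_in_nbhd :: "('a, 'b) pre_digraph \<Rightarrow> 'a set \<Rightarrow> 'a set" where
  "closed_in_nbhd D S = {u \<in> verts D. ddist_set D u S \<le> 1}"

definition independent_set :: "('a, 'b) pre_digraph \<Rightarrow> 'a set \<Rightarrow> bool" where
  "independent_set D S \<longleftrightarrow> S \<subseteq> verts D \<and> (\<forall>u\<in>S. \<forall>v\<in>S. \<not> u \<rightarrow>\<^bsub>D\<^esub> v)"

definition is_kernel :: "('a, 'b) pre_digraph \<Rightarrow> 'a set \<Rightarrow> bool" where
  "is_kernel D K \<longleftrightarrow> independent_set D K \<and> closed_in_nbhd D K = verts D"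

definition is_quasi_kernel :: "('a, 'b) pre_digraph \<Rightarrow> 'a set \<Rightarrow> bool" where
  "is_quasi_kernel D Q \<longleftrightarrow>
     independent_set D Q \<and> (\<forall>u\<in>verts D. ddist_set D u Q \<le> 2)"

definition kernel_perfect :: "('a, 'b) pre_digraph \<Rightarrow> bool" where
  "kernel_perfect D \<longleftrightarrow> (\<forall>S\<subseteq>verts D. \<exists>K. is_kernel (D \<restriction> S) K)"

definition kernel_perfect_set :: "('a, 'b) pre_digraph \<Rightarrow> 'a set \<Rightarrow> bool" where
  "kernel_perfect_set D S \<longleftrightarrow> S \<subseteq> verts D \<and> kernel_perfect (D \<restriction> S)"

text \<open>
  \<^const>\<open>partition_on\<close> asks for nonempty parts. Allowing empty parts would not change the
  minimum, since they can be dropped. The digraph without vertices has number 0.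
\<close>

definition kp :: "('a, 'b) pre_digraph \<Rightarrow> nat" where
  "kp D = (LEAST k. \<exists>P. partition_on (verts D) P \<and> finite P \<and> card P = k \<and>
                       (\<forall>S\<in>P. kernel_perfect_set D S))"

end

theory Submission
  imports Defs
begin

text \<open>
  The argument rests on one construction. Let \<open>S\<close> be kernel-perfect, let \<open>Q'\<close> be a
  quasi-kernel of the digraph induced on the vertices outside \<open>N\<^sup>-[S]\<close>, and let \<open>K\<close> be a
  kernel of the digraph induced on the vertices of \<open>S\<close> without an arc to \<open>Q'\<close>. Then
  \<open>Q = Q' \<union> K\<close> is a quasi-kernel of the whole digraph: a vertex with an arc to some \<open>s \<in> S\<close>
  reaches \<open>Q\<close> in at most two steps, because \<open>s\<close> is in \<open>K\<close> or has an arc to \<open>K\<close> or \<open>Q'\<close>. Two further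
  properties are visible from the construction: \<open>S \<subseteq> N\<^sup>-[Q]\<close>, and a vertex outside \<open>S\<close> with
  an arc to \<open>S\<close> is never in \<open>Q\<close>. This is \<open>qkernel_from_kperfect\<close>.

  Let \<open>V\<^sub>0, \<dots>, V\<^sub>k\<^sub>-\<^sub>1\<close> be kernel-perfect sets covering all vertices. Each of the three claims
  follows by averaging over \<open>k\<close> quasi-kernels.

  \<^item> For III, use the construction with \<open>S = V\<^sub>i\<close>; the sets \<open>N\<^sup>-[Q\<^sub>i]\<close> cover all vertices.

  \<^item> For II, use it with \<open>V\<^sub>i\<close> minus the set of sources that are not sinks. An out-neighbor of a
    source is not a source, so every source that is not a sink is missed by some \<open>Q\<^sub>i\<close>.

  \<^item> For I, first take from \<open>V\<^sub>0\<close> the set \<open>W\<close> of all vertices whose out-neighbors are all in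
    \<open>V\<^sub>0\<close>, and replace \<open>V\<^sub>1\<close> by \<open>W \<union> (V\<^sub>1 - V\<^sub>0)\<close>, which is kernel-perfect because no arc leads
    from \<open>W\<close> to \<open>V\<^sub>1 - V\<^sub>0\<close>. Then every vertex of the new \<open>V\<^sub>0\<close> has an out-neighbor outside it.
    Let \<open>R\<close> be the quasi-kernel obtained from the new \<open>V\<^sub>0\<close>, and \<open>Q\<^sub>i\<close> the one obtained from
    \<open>V\<^sub>i - R\<close> for \<open>i > 0\<close>. In a sink-free digraph, a vertex of \<open>R\<close> has an out-neighbor outside
    \<open>V\<^sub>0\<close> (if it is not in \<open>V\<^sub>0\<close>, then it has no arc to \<open>V\<^sub>0\<close>), and outside \<open>R\<close> by
    independence, hence in some \<open>V\<^sub>i - R\<close>; so it is missed by \<open>Q\<^sub>i\<close>. Thus every vertex is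
    missed by \<open>R\<close> or by some \<open>Q\<^sub>i\<close>.
\<close>

section \<open>Kernels and quasi-kernels of a relation on a set\<close>

text \<open>
  The combinatorics takes place in a relation \<open>r\<close> restricted to a set \<open>A\<close>, which stands for
  the digraph induced on \<open>A\<close>; distances are spelled out as the existence of short walks.
\<close>

definition indep_in :: "('a \<Rightarrow> 'a \<Rightarrow> bool) \<Rightarrow> 'a set \<Rightarrow> bool" where
  "indep_in r S \<longleftrightarrow> (\<forall>u\<in>S. \<forall>v\<in>S. \<not> r u v)"

definition kernel_on :: "('a \<Rightarrow> 'a \<Rightarrow> bool) \<Rightarrow> 'a set \<Rightarrow> 'a set \<Rightarrow> bool" where
  "kernel_on r A K \<longleftrightarrow> K \<subseteq> A \<and> indep_in r K \<and> (\<forall>u\<in>A - K. \<exists>v\<in>K. r u v)"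

definition qkernel_on :: "('a \<Rightarrow> 'a \<Rightarrow> bool) \<Rightarrow> 'a set \<Rightarrow> 'a set \<Rightarrow> bool" where
  "qkernel_on r A Q \<longleftrightarrow> Q \<subseteq> A \<and> indep_in r Q \<and>
     (\<forall>u\<in>A - Q. (\<exists>v\<in>Q. r u v) \<or> (\<exists>w\<in>A. \<exists>v\<in>Q. r u w \<and> r w v))"

definition kperfect_on :: "('a \<Rightarrow> 'a \<Rightarrow> bool) \<Rightarrow> 'a set \<Rightarrow> bool" where
  "kperfect_on r S \<longleftrightarrow> (\<forall>A\<subseteq>S. \<exists>K. kernel_on r A K)"

lemma kperfect_on_subset: "kperfect_on r S \<Longrightarrow> T \<subseteq> S \<Longrightarrow> kperfect_on r T"
  unfolding kperfect_on_def by blast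

lemma kperfect_on_empty: "kperfect_on r {}"
  unfolding kperfect_on_def kernel_on_def indep_in_def by blast

text \<open>
  A kernel of the part in \<open>S\<close> comes first; a kernel of the remaining vertices without an arc to
  it extends it, as no arc leads from \<open>S\<close> to \<open>T\<close>.
\<close>

lemma kperfect_on_Un:
  assumes S: "kperfect_on r S" and T: "kperfect_on r T"
    and no: "\<And>u v. u \<in> S \<Longrightarrow> v \<in> T \<Longrightarrow> \<not> r u v"
  shows "kperfect_on r (S \<union> T)"
  unfolding kperfect_on_def
proof (intro allI impI)
  fix A assume A: "A \<subseteq> S \<union> T"
  obtain K where K: "kernel_on r (A \<inter> S) K"
    using S unfolding kperfect_on_def by (meson inf_le2)
  define B where "B = {u \<in> A - S. \<forall>v\<in>K. \<not> r u v}"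
  have "B \<subseteq> T" using A B_def by blast
  then obtain L where L: "kernel_on r B L"
    using T unfolding kperfect_on_def by blast
  have "kernel_on r A (K \<union> L)"
    unfolding kernel_on_def
  proof (intro conjI ballI)
    show "K \<union> L \<subseteq> A" using K L unfolding kernel_on_def B_def by blast
    have "\<not> r u v" if "u \<in> K" "v \<in> L" for u v
      using no[of u v] that K L \<open>B \<subseteq> T\<close> unfolding kernel_on_def by blast
    moreover have "\<not> r u v" if "u \<in> L" "v \<in> K" for u v
      using that L unfolding kernel_on_def B_def by blast
    ultimately show "indep_in r (K \<union> L)"
      using K L unfolding kernel_on_def indep_in_def by blast
    show "\<exists>v\<in>K \<union> L. r u v" if "u \<in> A - (K \<union> L)" for u
      using that K L unfolding kernel_on_def B_def by blast
  qed
  then show "\<exists>K. kernel_on r A K" ..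
qed

text \<open>The theorem of Chvatal and Lovasz that every finite loopless digraph has a quasi-kernel.\<close>

lemma qkernel_on_exists:
  assumes "finite A" and "\<And>x. x \<in> A \<Longrightarrow> \<not> r x x"
  shows "\<exists>Q. qkernel_on r A Q"
  using assms
proof (induction A rule: finite_psubset_induct)
  case (psubset A)
  show ?case
  proof (cases "A = {}")
    case True
    then show ?thesis unfolding qkernel_on_def indep_in_def by blast
  next
    case False
    then obtain x where x: "x \<in> A" by blast
    define B where "B = {u \<in> A. u \<noteq> x \<and> \<not> r u x}"
    have "B \<subset> A" using x B_def by blast
    then obtain Q where Q: "qkernel_on r B Q"
      using psubset by blast
    show ?thesis
    proof (cases "\<exists>v\<in>Q. r x v")
      case True
      then have "qkernel_on r A Q"
        using Q x unfolding qkernel_on_def B_def by blast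
      then show ?thesis ..
    next
      case False
      then have "qkernel_on r A (insert x Q)"
        using Q x psubset.prems unfolding qkernel_on_def B_def indep_in_def by blast
      then show ?thesis ..
    qed
  qed
qed

text \<open>
  The main construction: some quasi-kernel dominates the kernel-perfect set \<open>S\<close> within one step
  and avoids every vertex outside \<open>S\<close> that has an arc to \<open>S\<close>.
\<close>

lemma qkernel_from_kperfect:
  assumes fin: "finite A" and irr: "\<And>x. x \<in> A \<Longrightarrow> \<not> r x x"
    and S: "S \<subseteq> A" "kperfect_on r S"
  obtains Q where "qkernel_on r A Q"
    and "\<And>u. u \<in> S \<Longrightarrow> u \<in> Q \<or> (\<exists>v\<in>Q. r u v)"
    and "\<And>u v. u \<in> Q \<Longrightarrow> u \<notin> S \<Longrightarrow> v \<in> S \<Longrightarrow> \<not> r u v"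
proof -
  define B where "B = {u \<in> A - S. \<forall>v\<in>S. \<not> r u v}"
  have "finite B" "\<And>x. x \<in> B \<Longrightarrow> \<not> r x x" using fin irr B_def by auto
  then obtain Q' where Q': "qkernel_on r B Q'"
    using qkernel_on_exists[of B r] by blast
  have Q'B: "Q' \<subseteq> B" using Q' unfolding qkernel_on_def by blast
  define C where "C = {u \<in> S. \<forall>v\<in>Q'. \<not> r u v}"
  have "C \<subseteq> S" using C_def by blast
  then obtain K where K: "kernel_on r C K"
    using S unfolding kperfect_on_def by blast
  have KS: "K \<subseteq> S" using K \<open>C \<subseteq> S\<close> unfolding kernel_on_def by blast
  have dom: "u \<in> Q' \<union> K \<or> (\<exists>v\<in>Q' \<union> K. r u v)" if "u \<in> S" for u
    using that K unfolding kernel_on_def C_def by blast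
  have no: "\<not> r u v" if "u \<in> Q' \<union> K" "u \<notin> S" "v \<in> S" for u v
    using that Q'B KS unfolding B_def by blast
  have "qkernel_on r A (Q' \<union> K)"
    unfolding qkernel_on_def
  proof (intro conjI ballI)
    show "Q' \<union> K \<subseteq> A" using Q'B KS S B_def by blast
    have "\<not> r u v" if "u \<in> Q'" "v \<in> K" for u v
      using that Q'B KS unfolding B_def by blast
    moreover have "\<not> r u v" if "u \<in> K" "v \<in> Q'" for u v
      using that K unfolding kernel_on_def C_def by blast
    ultimately show "indep_in r (Q' \<union> K)"
      using Q' K unfolding qkernel_on_def kernel_on_def indep_in_def by blast
    fix u assume u: "u \<in> A - (Q' \<union> K)"
    consider "u \<in> S" | "u \<in> B" | s where "s \<in> S" "r u s"
      using u unfolding B_def by blast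
    then show "(\<exists>v\<in>Q' \<union> K. r u v) \<or> (\<exists>w\<in>A. \<exists>v\<in>Q' \<union> K. r u w \<and> r w v)"
    proof cases
      case 1
      then show ?thesis using dom u by blast
    next
      case 2
      then show ?thesis using Q' u unfolding qkernel_on_def B_def by blast
    next
      case 3
      then show ?thesis using dom[of s] S by blast
    qed
  qed
  then show ?thesis using that dom no by blast
qed

section \<open>Families of quasi-kernels from a kernel-perfect cover\<close>

lemma qkernel_family_dominating:
  fixes k :: nat
  assumes fin: "finite A" and irr: "\<And>x. x \<in> A \<Longrightarrow> \<not> r x x"
    and cover: "A = (\<Union>i<k. V i)" and V: "\<And>i. i < k \<Longrightarrow> kperfect_on r (V i)"
  obtains Q where "\<And>i. i < k \<Longrightarrow> qkernel_on r A (Q i)"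
    and "\<And>v. v \<in> A \<Longrightarrow> \<exists>i<k. v \<in> Q i \<or> (\<exists>w\<in>Q i. r v w)"
proof -
  have "\<exists>Q. qkernel_on r A Q \<and> (\<forall>u\<in>V i. u \<in> Q \<or> (\<exists>v\<in>Q. r u v))" if "i < k" for i
    using qkernel_from_kperfect[where r = r, OF fin irr _ V[OF that]] cover that by (metis UN_upper lessThan_iff)
  then obtain Q where "\<And>i. i < k \<Longrightarrow> qkernel_on r A (Q i) \<and>
      (\<forall>u\<in>V i. u \<in> Q i \<or> (\<exists>v\<in>Q i. r u v))"
    by metis
  then show ?thesis using that[of Q] cover by blast
qed

text \<open>
  Applied with \<open>X\<close> the set of sources that are not sinks. Taking \<open>X\<close> out of each member of the
  cover puts every \<open>x \<in> X\<close> outside the sets \<open>V i - X\<close>, one of which contains an out-neighbor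
  of \<open>x\<close>.
\<close>

lemma qkernel_family_missing:
  fixes k :: nat
  assumes fin: "finite A" and irr: "\<And>x. x \<in> A \<Longrightarrow> \<not> r x x"
    and cover: "A = (\<Union>i<k. V i)" and V: "\<And>i. i < k \<Longrightarrow> kperfect_on r (V i)"
    and X: "\<And>x. x \<in> X \<Longrightarrow> \<exists>y\<in>A - X. r x y"
  obtains Q where "\<And>i. i < k \<Longrightarrow> qkernel_on r A (Q i)"
    and "\<And>x. x \<in> X \<Longrightarrow> \<exists>i<k. x \<notin> Q i"
proof -
  have "\<exists>Q. qkernel_on r A Q \<and> (\<forall>u\<in>Q. u \<notin> V i - X \<longrightarrow> (\<forall>v\<in>V i - X. \<not> r u v))"
    if "i < k" for i
  proof -
    have "kperfect_on r (V i - X)" using V[OF that] kperfect_on_subset by blast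
    moreover have "V i - X \<subseteq> A" using cover that by blast
    ultimately show ?thesis
      using qkernel_from_kperfect[where r = r and S = "V i - X", OF fin irr] by metis
  qed
  then obtain Q where Q: "\<And>i. i < k \<Longrightarrow> qkernel_on r A (Q i) \<and>
      (\<forall>u\<in>Q i. u \<notin> V i - X \<longrightarrow> (\<forall>v\<in>V i - X. \<not> r u v))"
    by metis
  have "\<exists>i<k. x \<notin> Q i" if "x \<in> X" for x
  proof -
    obtain y where y: "y \<in> A - X" "r x y" using X[OF \<open>x \<in> X\<close>] by blast
    then obtain i where "i < k" "y \<in> V i" using cover by blast
    then show ?thesis using Q[of i] y that by blast
  qed
  then show ?thesis using that[of Q] Q by blast
qed

text \<open>
  The cover is modified so that every vertex of its member with index 0 has an out-neighbor
  outside this member. This is where at least two members are needed.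
\<close>

lemma kperfect_cover_improve:
  fixes k :: nat
  assumes k: "2 \<le> k"
    and cover: "A = (\<Union>i<k. V i)" and V: "\<And>i. i < k \<Longrightarrow> kperfect_on r (V i)"
  obtains V' where "A = (\<Union>i<k. V' i)" and "\<And>i. i < k \<Longrightarrow> kperfect_on r (V' i)"
    and "\<And>v. v \<in> V' 0 \<Longrightarrow> \<exists>w\<in>A - V' 0. r v w"
proof -
  define W where "W = {v \<in> V 0. \<forall>w\<in>A. r v w \<longrightarrow> w \<in> V 0}"
  define V' where "V' = V(0 := V 0 - W, 1 := W \<union> (V 1 - V 0))"
  have "W \<subseteq> V 0" using W_def by blast
  have VA: "V i \<subseteq> A" if "i < k" for i using cover that by blast
  have V'0: "V' 0 = V 0 - W" and V'1: "V' 1 = W \<union> (V 1 - V 0)"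
    and V'i: "\<And>i. 2 \<le> i \<Longrightarrow> V' i = V i"
    unfolding V'_def by simp_all
  show ?thesis
  proof (rule that[of V'])
    have "x \<in> (\<Union>i<k. V' i)" if "x \<in> A" for x
    proof (cases "x \<in> V 0")
      case True
      then have "x \<in> V' 0 \<or> x \<in> V' 1" using V'0 V'1 by blast
      moreover have "0 < k" "1 < k" using k by auto
      ultimately show ?thesis by blast
    next
      case False
      obtain i where i: "i < k" "x \<in> V i" using \<open>x \<in> A\<close> cover by blast
      then have "i \<noteq> 0" using False by metis
      then have "i = 1 \<or> 2 \<le> i" by linarith
      then have "x \<in> V' i" using V'1 V'i i False by auto
      then show ?thesis using i by blast
    qed
    moreover have "V' i \<subseteq> A" if "i < k" for i
    proof -
      have sub: "V 0 \<subseteq> A" "V 1 \<subseteq> A" using VA[of 0] VA[of 1] k by simp_all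
      consider "i = 0" | "i = 1" | "2 \<le> i" by linarith
      then show ?thesis
      proof cases
        case 1
        then show ?thesis using V'0 sub by blast
      next
        case 2
        then show ?thesis using V'1 sub \<open>W \<subseteq> V 0\<close> by blast
      next
        case 3
        then show ?thesis using V'i VA \<open>i < k\<close> by simp
      qed
    qed
    ultimately show "A = (\<Union>i<k. V' i)" by blast
  next
    fix i assume "i < k"
    consider "i = 0" | "i = 1" | "2 \<le> i" by linarith
    then show "kperfect_on r (V' i)"
    proof cases
      case 1
      then show ?thesis
        using V[of 0] \<open>i < k\<close> V'0 kperfect_on_subset[of r "V 0" "V 0 - W"] by auto
    next
      case 2
      have "kperfect_on r W"
        using V[of 0] k \<open>W \<subseteq> V 0\<close> kperfect_on_subset by (metis not_gr_zero not_numeral_le_zero)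
      moreover have "kperfect_on r (V 1 - V 0)"
        using V[of 1] k kperfect_on_subset[of r "V 1" "V 1 - V 0"] by auto
      moreover have "\<not> r u v" if "u \<in> W" "v \<in> V 1 - V 0" for u v
        using that VA[of 1] k unfolding W_def by auto
      ultimately have "kperfect_on r (W \<union> (V 1 - V 0))" by (rule kperfect_on_Un)
      then show ?thesis using 2 V'1 by simp
    next
      case 3
      then show ?thesis using V V'i \<open>i < k\<close> by simp
    qed
  next
    fix v assume "v \<in> V' 0"
    then show "\<exists>w\<in>A - V' 0. r v w" using V'0 W_def by blast
  qed
qed

lemma qkernel_family_missing_all:
  fixes k :: nat
  assumes fin: "finite A" and irr: "\<And>x. x \<in> A \<Longrightarrow> \<not> r x x" and k: "2 \<le> k"
    and cover: "A = (\<Union>i<k. V i)" and V: "\<And>i. i < k \<Longrightarrow> kperfect_on r (V i)"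
    and sf: "\<And>x. x \<in> A \<Longrightarrow> \<exists>y\<in>A. r x y"
  obtains Q where "\<And>i. i < k \<Longrightarrow> qkernel_on r A (Q i)"
    and "\<And>v. v \<in> A \<Longrightarrow> \<exists>i<k. v \<notin> Q i"
proof -
  obtain U where U: "A = (\<Union>i<k. U i)" "\<And>i. i < k \<Longrightarrow> kperfect_on r (U i)"
    and out: "\<And>v. v \<in> U 0 \<Longrightarrow> \<exists>w\<in>A - U 0. r v w"
    using kperfect_cover_improve[OF k cover V] by metis
  have "U 0 \<subseteq> A" "kperfect_on r (U 0)" using U k by auto
  then obtain R where R: "qkernel_on r A R"
    and R0: "\<And>u v. u \<in> R \<Longrightarrow> u \<notin> U 0 \<Longrightarrow> v \<in> U 0 \<Longrightarrow> \<not> r u v"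
    using qkernel_from_kperfect[where r = r and S = "U 0", OF fin irr] by metis
  \<comment> \<open>A vertex of \<open>R\<close> in \<open>U 0\<close> has an out-neighbor outside \<open>U 0\<close> by the choice of the cover;
      for one not in \<open>U 0\<close>, every out-neighbor is outside \<open>U 0\<close>.\<close>
  have target: "\<exists>w\<in>A - U 0 - R. r v w" if "v \<in> R" for v
  proof -
    have "v \<in> A" using R that unfolding qkernel_on_def by blast
    then have "\<exists>w\<in>A - U 0. r v w"
      using out[of v] R0[OF that] sf[of v] by blast
    then show ?thesis using R that unfolding qkernel_on_def indep_in_def by blast
  qed
  have "\<exists>Q. qkernel_on r A Q \<and> (\<forall>u\<in>Q. u \<notin> U i - R \<longrightarrow> (\<forall>v\<in>U i - R. \<not> r u v))"
    if "i < k" for i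
  proof -
    have "kperfect_on r (U i - R)" using U(2)[OF that] kperfect_on_subset by blast
    moreover have "U i - R \<subseteq> A" using U(1) that by blast
    ultimately show ?thesis
      using qkernel_from_kperfect[where r = r and S = "U i - R", OF fin irr] by metis
  qed
  then obtain Q where Q: "\<And>i. i < k \<Longrightarrow> qkernel_on r A (Q i) \<and>
      (\<forall>u\<in>Q i. u \<notin> U i - R \<longrightarrow> (\<forall>v\<in>U i - R. \<not> r u v))"
    by metis
  define P where "P = Q(0 := R)"
  have P0: "P 0 = R" and Pi: "\<And>i. i \<noteq> 0 \<Longrightarrow> P i = Q i" unfolding P_def by simp_all
  show ?thesis
  proof (rule that[of P])
    show "qkernel_on r A (P i)" if "i < k" for i
      using that Q R P0 Pi by (cases "i = 0") auto
    show "\<exists>i<k. v \<notin> P i" if "v \<in> A" for v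
    proof (cases "v \<in> R")
      case True
      then obtain w where w: "w \<in> A - U 0 - R" "r v w" using target by blast
      then obtain i where i: "i < k" "w \<in> U i" using U(1) by blast
      then have "i \<noteq> 0" using w by (metis DiffD1 DiffD2)
      moreover have "v \<notin> Q i" using Q[OF i(1)] i w True by blast
      ultimately show ?thesis using Pi i(1) by metis
    next
      case False
      moreover have "0 < k" using k by simp
      ultimately show ?thesis using P0 by metis
    qed
  qed
qed

section \<open>Translation from digraphs\<close>

lemma adj_induce_subgraph:
  "u \<rightarrow>\<^bsub>D \<restriction> S\<^esub> v \<longleftrightarrow> u \<in> S \<and> v \<in> S \<and> u \<rightarrow>\<^bsub>D\<^esub> v"
  unfolding arcs_ends_def arc_to_ends_def by (auto simp: induce_subgraph_def)

lemma ddist_le_iff: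
  "ddist D u v \<le> enat m \<longleftrightarrow> (\<exists>p. pre_digraph.apath D u p v \<and> length p \<le> m)"
proof
  assume "ddist D u v \<le> enat m"
  then have "ddist D u v < enat (Suc m)" by (simp add: order_le_less_trans)
  then show "\<exists>p. pre_digraph.apath D u p v \<and> length p \<le> m"
    unfolding ddist_def INF_less_iff by auto
next
  assume "\<exists>p. pre_digraph.apath D u p v \<and> length p \<le> m"
  then obtain p where "pre_digraph.apath D u p v" "length p \<le> m" by blast
  then show "ddist D u v \<le> enat m"
    unfolding ddist_def by (intro INF_lower2[of p]) auto
qed

lemma ddist_set_le_iff:
  "ddist_set D u S \<le> enat m \<longleftrightarrow> (\<exists>v\<in>S. ddist D u v \<le> enat m)"
proof
  assume "ddist_set D u S \<le> enat m"
  then have "ddist_set D u S < enat (Suc m)" by (simp add: order_le_less_trans)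
  then obtain v where "v \<in> S" "ddist D u v < enat (Suc m)"
    unfolding ddist_set_def INF_less_iff by blast
  then show "\<exists>v\<in>S. ddist D u v \<le> enat m"
    by (intro bexI[of _ v], cases "ddist D u v") auto
next
  assume "\<exists>v\<in>S. ddist D u v \<le> enat m"
  then show "ddist_set D u S \<le> enat m"
    unfolding ddist_set_def by (meson INF_lower2)
qed

lemma ddist_le_1_iff:
  assumes "digraph D"
  shows "ddist D u v \<le> 1 \<longleftrightarrow> (u \<in> verts D \<and> u = v) \<or> u \<rightarrow>\<^bsub>D\<^esub> v"
proof -
  interpret digraph D by fact
  have "ddist D u v \<le> 1 \<longleftrightarrow> (\<exists>p. apath u p v \<and> length p \<le> 1)"
    using ddist_le_iff[of D u v 1] by (simp add: one_enat_def)
  also have "\<dots> \<longleftrightarrow> (u \<in> verts D \<and> u = v) \<or> u \<rightarrow>\<^bsub>D\<^esub> v" (is "?L \<longleftrightarrow> ?R")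
  proof
    assume ?L
    then obtain p where p: "apath u p v" "length p \<le> 1" by blast
    then consider "p = []" | a where "p = [a]"
      by (cases p) auto
    then show ?R
      using p by cases (auto simp: apath_def awalk_simps arcs_ends_conv)
  next
    assume R: ?R
    show ?L
    proof (cases "u \<in> verts D \<and> u = v")
      case True
      then have "apath u [] v" by (auto simp: apath_def awalk_simps)
      then show ?thesis by (intro exI[of _ "[]"]) simp
    next
      case False
      then obtain a where a: "a \<in> arcs D" "tail D a = u" "head D a = v"
        using R by (auto simp: arcs_ends_conv)
      then have "apath u [a] v"
        using no_loops[OF a(1)] by (auto simp: apath_def awalk_simps)
      then show ?thesis by (intro exI[of _ "[a]"]) simp
    qed
  qed
  finally show ?thesis .
qed

lemma ddist_le_2I:
  assumes "digraph D" and "u \<rightarrow>\<^bsub>D\<^esub> w" and "w \<rightarrow>\<^bsub>D\<^esub> v" and "u \<noteq> v"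
  shows "ddist D u v \<le> 2"
proof -
  interpret digraph D by fact
  obtain a b where a: "a \<in> arcs D" "tail D a = u" "head D a = w"
    and b: "b \<in> arcs D" "tail D b = w" "head D b = v"
    using assms by (auto simp: arcs_ends_conv)
  then have "apath u [a, b] v"
    using no_loops[OF a(1)] no_loops[OF b(1)] \<open>u \<noteq> v\<close> by (auto simp: apath_def awalk_simps)
  then have "ddist D u v \<le> enat 2"
    unfolding ddist_le_iff by (intro exI[of _ "[a, b]"]) simp
  then show ?thesis by (simp add: numeral_eq_enat)
qed

lemma mem_closed_in_nbhd_iff:
  assumes "digraph D" and "S \<subseteq> verts D"
  shows "u \<in> closed_in_nbhd D S \<longleftrightarrow> u \<in> S \<or> (\<exists>v\<in>S. u \<rightarrow>\<^bsub>D\<^esub> v)"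
proof -
  interpret digraph D by fact
  show ?thesis
    using assms(2) ddist_set_le_iff[of D u S 1] ddist_le_1_iff[OF assms(1), of u]
    unfolding closed_in_nbhd_def by (auto simp: one_enat_def)
qed

lemma is_kernel_iff:
  assumes "digraph D"
  shows "is_kernel D K \<longleftrightarrow> kernel_on (\<lambda>u v. u \<rightarrow>\<^bsub>D\<^esub> v) (verts D) K"
proof (cases "K \<subseteq> verts D")
  case True
  interpret digraph D by fact
  have "closed_in_nbhd D K \<subseteq> verts D" unfolding closed_in_nbhd_def by blast
  then show ?thesis
    using True mem_closed_in_nbhd_iff[OF assms True]
    unfolding is_kernel_def kernel_on_def independent_set_def indep_in_def by blast
qed (auto simp: is_kernel_def kernel_on_def independent_set_def)

lemma is_quasi_kernelI:
  assumes D: "digraph D" and Q: "qkernel_on (\<lambda>u v. u \<rightarrow>\<^bsub>D\<^esub> v) (verts D) Q"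
  shows "is_quasi_kernel D Q"
proof -
  have "ddist_set D u Q \<le> enat 2" if u: "u \<in> verts D" for u
  proof -
    have le: "ddist D u v \<le> enat 2" if "ddist D u v \<le> 1" for v
      using that by (rule order_trans) (simp add: one_enat_def)
    have "\<exists>v\<in>Q. ddist D u v \<le> enat 2"
    proof (cases "u \<in> Q \<or> (\<exists>v\<in>Q. u \<rightarrow>\<^bsub>D\<^esub> v)")
      case True
      then show ?thesis using le ddist_le_1_iff[OF D] u by metis
    next
      case False
      then obtain w v where "v \<in> Q" "u \<rightarrow>\<^bsub>D\<^esub> w" "w \<rightarrow>\<^bsub>D\<^esub> v"
        using Q u unfolding qkernel_on_def by blast
      then have "ddist D u v \<le> enat 2"
        using ddist_le_2I[OF D] False by (metis numeral_eq_enat)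
      then show ?thesis using \<open>v \<in> Q\<close> by blast
    qed
    then show ?thesis by (simp add: ddist_set_le_iff)
  qed
  then show ?thesis
    using Q unfolding is_quasi_kernel_def qkernel_on_def independent_set_def indep_in_def
    by (simp add: numeral_eq_enat)
qed

lemma kernel_perfect_set_iff:
  assumes "digraph D"
  shows "kernel_perfect_set D S \<longleftrightarrow> S \<subseteq> verts D \<and> kperfect_on (\<lambda>u v. u \<rightarrow>\<^bsub>D\<^esub> v) S"
proof -
  interpret digraph D by fact
  have "is_kernel ((D \<restriction> S) \<restriction> T) K \<longleftrightarrow> kernel_on (\<lambda>u v. u \<rightarrow>\<^bsub>D\<^esub> v) T K"
    if "S \<subseteq> verts D" "T \<subseteq> S" for T K
  proof -
    interpret S: digraph "D \<restriction> S"
      using digraphI_induced[OF induced_induce[OF that(1)]] .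
    have "digraph ((D \<restriction> S) \<restriction> T)"
      using S.digraphI_induced[OF S.induced_induce[of T]] that(2) by simp
    then have "is_kernel ((D \<restriction> S) \<restriction> T) K \<longleftrightarrow>
        kernel_on (\<lambda>u v. u \<rightarrow>\<^bsub>(D \<restriction> S) \<restriction> T\<^esub> v) T K"
      by (simp add: is_kernel_iff)
    also have "\<dots> \<longleftrightarrow> kernel_on (\<lambda>u v. u \<rightarrow>\<^bsub>D\<^esub> v) T K"
      unfolding kernel_on_def indep_in_def adj_induce_subgraph using that(2) by blast
    finally show ?thesis .
  qed
  then show ?thesis
    unfolding kernel_perfect_set_def kernel_perfect_def kperfect_on_def induce_subgraph_verts
    by meson
qed

text \<open>
  Padding an optimal partition with empty sets gives a cover indexed by any \<open>k\<close> from \<open>kp D\<close> on.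
  The partition into singletons shows that \<open>kp D\<close> is the minimum of a nonempty set.
\<close>

lemma kperfect_cover_exists:
  assumes D: "digraph D" and k: "kp D \<le> k"
  obtains V where "verts D = (\<Union>i<k. V i)"
    and "\<And>i. i < k \<Longrightarrow> kperfect_on (\<lambda>u v. u \<rightarrow>\<^bsub>D\<^esub> v) (V i)"
proof -
  interpret digraph D by fact
  let ?r = "\<lambda>u v. u \<rightarrow>\<^bsub>D\<^esub> v"
  let ?P = "\<lambda>j. \<exists>P. partition_on (verts D) P \<and> finite P \<and> card P = j \<and>
              (\<forall>S\<in>P. kernel_perfect_set D S)"
  have single: "kernel_perfect_set D {v}" if "v \<in> verts D" for v
  proof -
    have "\<not> v \<rightarrow>\<^bsub>D\<^esub> v" using adj_not_same by blast
    then have "kernel_on ?r A A" if "A \<subseteq> {v}" for A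
      using that unfolding kernel_on_def indep_in_def by blast
    then show ?thesis
      using kernel_perfect_set_iff[OF D] that unfolding kperfect_on_def by blast
  qed
  have "partition_on (verts D) ((\<lambda>v. {v}) ` verts D)"
    by (auto simp: partition_on_def disjoint_def)
  then have "?P (card ((\<lambda>v. {v}) ` verts D))"
    using single by (intro exI[of _ "(\<lambda>v. {v}) ` verts D"]) auto
  then have "?P (kp D)" unfolding kp_def by (rule LeastI)
  then obtain P where P: "partition_on (verts D) P" "finite P" "card P = kp D"
    "\<And>S. S \<in> P \<Longrightarrow> kernel_perfect_set D S" by blast
  obtain f where f: "bij_betw f {0..<kp D} P"
    using ex_bij_betw_nat_finite[OF P(2)] P(3) by metis
  define V where "V i = (if i < kp D then f i else {})" for i
  show ?thesis
  proof (rule that[of V])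
    have "(\<Union>i<k. V i) = (\<Union>i<kp D. f i)"
    proof (intro equalityI subsetI)
      show "x \<in> (\<Union>i<kp D. f i)" if "x \<in> (\<Union>i<k. V i)" for x
        using that unfolding V_def by (auto split: if_splits)
      fix x assume "x \<in> (\<Union>i<kp D. f i)"
      then obtain i where "i < kp D" "x \<in> f i" by blast
      then have "i < k" "x \<in> V i" using k V_def by simp_all
      then show "x \<in> (\<Union>i<k. V i)" by blast
    qed
    also have "\<dots> = \<Union>P"
      using f unfolding bij_betw_def by (simp add: atLeast0LessThan)
    finally show "verts D = (\<Union>i<k. V i)" using P(1) by (simp add: partition_on_def)
    show "kperfect_on ?r (V i)" for i
    proof (cases "i < kp D")
      case True
      then have "f i \<in> P" using f unfolding bij_betw_def by auto
      then show ?thesis using P(4) kernel_perfect_set_iff[OF D] True V_def by simp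
    qed (simp add: V_def kperfect_on_empty)
  qed
qed

section \<open>Averaging\<close>

lemma exists_large_member:
  fixes k :: nat
  assumes "0 < k" and "\<And>i. i < k \<Longrightarrow> finite (B i)" and "A \<subseteq> (\<Union>i<k. B i)"
  obtains i where "i < k" and "real (card A) / real k \<le> real (card (B i))"
proof -
  have "card A \<le> card (\<Union>i<k. B i)" using assms by (intro card_mono) auto
  also have "\<dots> \<le> (\<Sum>i<k. card (B i))" by (rule card_UN_le) simp
  finally have le: "real (card A) \<le> (\<Sum>i<k. real (card (B i)))"
    by (metis of_nat_le_iff of_nat_sum)
  have "\<exists>i<k. real (card A) / real k \<le> real (card (B i))"
  proof (rule ccontr)
    assume "\<not> ?thesis"
    then have "(\<Sum>i<k. real (card (B i))) < (\<Sum>i<k. real (card A) / real k)"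
      using \<open>0 < k\<close> by (intro sum_strict_mono) auto
    then show False using le \<open>0 < k\<close> by simp
  qed
  then show ?thesis using that by blast
qed

lemma exists_small_quasi_kernel:
  fixes k :: nat
  assumes D: "digraph D" and k: "0 < k" and X: "X \<subseteq> verts D"
    and Q: "\<And>i. i < k \<Longrightarrow> qkernel_on (\<lambda>u v. u \<rightarrow>\<^bsub>D\<^esub> v) (verts D) (Q i)"
    and miss: "\<And>x. x \<in> X \<Longrightarrow> \<exists>i<k. x \<notin> Q i"
  shows "\<exists>Q. is_quasi_kernel D Q \<and> real (card Q) \<le> real (card (verts D)) - real (card X) / real k"
proof -
  interpret digraph D by fact
  have "X \<subseteq> (\<Union>i<k. verts D - Q i)" using X miss by blast
  then obtain i where i: "i < k" "real (card X) / real k \<le> real (card (verts D - Q i))"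
    using exists_large_member[of k "\<lambda>i. verts D - Q i" X] k by auto
  have "Q i \<subseteq> verts D" using Q[OF i(1)] unfolding qkernel_on_def by blast
  then have "card (verts D - Q i) + card (Q i) = card (verts D)"
    by (metis card_Diff_subset card_mono finite_subset finite_verts le_add_diff_inverse2)
  then have "real (card (Q i)) \<le> real (card (verts D)) - real (card X) / real k"
    using i(2) by linarith
  then show ?thesis using is_quasi_kernelI[OF D Q[OF i(1)]] by blast
qed

theorem theorem1p9:
  fixes D :: "('a, 'b) pre_digraph" and n k s :: nat
  assumes "digraph D"
    and "n = card (verts D)"
    and "k = max (kp D) 2"
    and "s = card {v. is_source D v \<and> \<not> is_sink D v}"
  shows "(sink_free D \<longrightarrow>
            (\<exists>Q. is_quasi_kernel D Q \<and> real (card Q) \<le> (1 - 1 / real k) * real n)) \<and>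
         (\<exists>Q. is_quasi_kernel D Q \<and> real (card Q) \<le> real n - real s / real k) \<and>
         (\<exists>Q. is_quasi_kernel D Q \<and> real (card (closed_in_nbhd D Q)) \<ge> real n / real k)"
proof -
  interpret digraph D by fact
  let ?r = "\<lambda>u v. u \<rightarrow>\<^bsub>D\<^esub> v"
  have irr: "\<And>x. x \<in> verts D \<Longrightarrow> \<not> ?r x x" using adj_not_same by blast
  have k: "2 \<le> k" "0 < k" "kp D \<le> k" using assms(3) by auto
  obtain V where V: "verts D = (\<Union>i<k. V i)" "\<And>i. i < k \<Longrightarrow> kperfect_on ?r (V i)"
    using kperfect_cover_exists[OF assms(1) k(3)] by metis
  show ?thesis
  proof (intro conjI impI)
    assume "sink_free D"
    then have sf: "\<And>x. x \<in> verts D \<Longrightarrow> \<exists>y\<in>verts D. ?r x y"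
      unfolding sink_free_def is_sink_def out_neighbors_def using adj_in_verts(2) by blast
    obtain Q where "\<And>i. i < k \<Longrightarrow> qkernel_on ?r (verts D) (Q i)"
      and "\<And>v. v \<in> verts D \<Longrightarrow> \<exists>i<k. v \<notin> Q i"
      using qkernel_family_missing_all[where r = ?r, OF finite_verts irr k(1) V sf] by metis
    then have "\<exists>Q. is_quasi_kernel D Q \<and> real (card Q) \<le> real n - real n / real k"
      unfolding assms(2) by (rule exists_small_quasi_kernel[OF assms(1) k(2) subset_refl])
    then show "\<exists>Q. is_quasi_kernel D Q \<and> real (card Q) \<le> (1 - 1 / real k) * real n"
      by (simp add: left_diff_distrib)
  next
    define X where "X = {v. is_source D v \<and> \<not> is_sink D v}"
    have X: "\<exists>y\<in>verts D - X. ?r x y" if x: "x \<in> X" for x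
    proof -
      obtain y where y: "?r x y"
        using x unfolding X_def is_source_def is_sink_def out_neighbors_def by blast
      then have "y \<notin> X" unfolding X_def is_source_def in_neighbors_def by blast
      then show ?thesis using y adj_in_verts(2) by blast
    qed
    have XV: "X \<subseteq> verts D" unfolding X_def is_source_def by blast
    obtain Q where "\<And>i. i < k \<Longrightarrow> qkernel_on ?r (verts D) (Q i)"
      and "\<And>x. x \<in> X \<Longrightarrow> \<exists>i<k. x \<notin> Q i"
      using qkernel_family_missing[where r = ?r, OF finite_verts irr V X] by metis
    then show "\<exists>Q. is_quasi_kernel D Q \<and> real (card Q) \<le> real n - real s / real k"
      unfolding assms(2,4) X_def[symmetric]
      by (rule exists_small_quasi_kernel[OF assms(1) k(2) XV])
  next
    obtain Q where Q: "\<And>i. i < k \<Longrightarrow> qkernel_on ?r (verts D) (Q i)"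
      and dom: "\<And>v. v \<in> verts D \<Longrightarrow> \<exists>i<k. v \<in> Q i \<or> (\<exists>w\<in>Q i. ?r v w)"
      using qkernel_family_dominating[where r = ?r, OF finite_verts irr V] by metis
    have QV: "Q i \<subseteq> verts D" if "i < k" for i
      using Q[OF that] unfolding qkernel_on_def by blast
    have "verts D \<subseteq> (\<Union>i<k. closed_in_nbhd D (Q i))"
    proof
      fix v assume "v \<in> verts D"
      then obtain i where i: "i < k" "v \<in> Q i \<or> (\<exists>w\<in>Q i. ?r v w)" using dom by blast
      then have "v \<in> closed_in_nbhd D (Q i)"
        using mem_closed_in_nbhd_iff[OF assms(1) QV] by simp
      then show "v \<in> (\<Union>i<k. closed_in_nbhd D (Q i))" using i(1) by blast
    qed
    moreover have "finite (closed_in_nbhd D S)" for S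
      unfolding closed_in_nbhd_def by simp
    ultimately obtain i where "i < k" "real n / real k \<le> real (card (closed_in_nbhd D (Q i)))"
      unfolding assms(2)
      using exists_large_member[of k "\<lambda>i. closed_in_nbhd D (Q i)" "verts D"] k(2) by metis
    then show "\<exists>Q. is_quasi_kernel D Q \<and> real (card (closed_in_nbhd D Q)) \<ge> real n / real k"
      using is_quasi_kernelI[OF assms(1) Q] by blast
  qed
qed

end
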